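(* Let $K:\mathbb{R}^n\to[0,\infty)$ be a measurable kernel and, for $u:\mathbb{R}^n\to\mathbb{R}$, let $$\mathcal{I}u(x)=-\int_{\mathbb{R}^n}\left(u(x+y)+u(x-y)-2u(x)\right)K(y)\,dy.$$ Let $\varphi:\mathbb{R}\to\mathbb{R}$ be a convex function of class $C^2$, let $u:\mathbb{R}^n\to\mathbb{R}$, and let $x\in\mathbb{R}^n$ be a point at which the integrals defining $\mathcal{I}u(x)$ and $\mathcal{I}(\varphi\circ u)(x)$ converge absolutely. Then $$\mathcal{I}(\varphi\circ u)(x)\;\le\;\varphi'(u(x))\,\mathcal{I}u(x).$$ *)

theory Defs
  imports "HOL-Analysis.Analysis"
begin

definition C2 :: "(real \<Rightarrow> real) \<Rightarrow> bool" where
  "C2 \<phi> \<longleftrightarrow> (\<forall>t. \<phi> differentiable at t) \<and> (\<forall>t. deriv \<phi> differentiable at t)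
     \<and> continuous_on UNIV (deriv (deriv \<phi>))"

definition nonlocal_integrand ::
    "(real ^ 'n \<Rightarrow> real) \<Rightarrow> (real ^ 'n \<Rightarrow> real) \<Rightarrow> real ^ 'n \<Rightarrow> real ^ 'n \<Rightarrow> real" where
  "nonlocal_integrand K u x y = (u (x + y) + u (x - y) - 2 * u x) * K y"

text \<open>The Bochner integral is 0 on non-integrable functions, so the value below is meaningful only
  where \<open>nonlocal_converges\<close> holds. The measure is the completed one, so that ``measurable''
  and the integral are in the sense of Lebesgue.\<close>

definition nonlocal_operator ::
    "(real ^ 'n \<Rightarrow> real) \<Rightarrow> (real ^ 'n \<Rightarrow> real) \<Rightarrow> real ^ 'n \<Rightarrow> real" where
  "nonlocal_operator K u x = - (LINT y|lebesgue. nonlocal_integrand K u x y)"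

definition nonlocal_converges ::
    "(real ^ 'n \<Rightarrow> real) \<Rightarrow> (real ^ 'n \<Rightarrow> real) \<Rightarrow> real ^ 'n \<Rightarrow> bool" where
  "nonlocal_converges K u x \<longleftrightarrow> integrable lebesgue (nonlocal_integrand K u x)"

end

theory Submission
  imports Defs
begin

text \<open>A convex differentiable function lies above its tangent line at \<open>u x\<close>. Adding this inequality
  at \<open>u (x + y)\<close> and \<open>u (x - y)\<close>, the second difference of \<open>\<phi> \<circ> u\<close> dominates
  \<open>\<phi>' (u x)\<close> times that of \<open>u\<close>; it remains to integrate against \<open>K \<ge> 0\<close>.\<close>

lemma nonlocal_integrand_convex_comp_ge:
  assumes convex: "convex_on UNIV \<phi>"
    and deriv: "(\<phi> has_real_derivative d) (at (u x))"
    and K: "0 \<le> K y"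
  shows "d * nonlocal_integrand K u x y \<le> nonlocal_integrand K (\<phi> \<circ> u) x y"
proof -
  \<comment> \<open>The domain is the whole line, so \<open>u x\<close> is an interior point and the
    tangent bound holds for every real \<open>t\<close>, whatever the sign of
    \<open>d\<close>.\<close>
  have tangent: "d * (t - u x) \<le> \<phi> t - \<phi> (u x)" for t
    using convex_on_imp_above_tangent[OF convex, of "u x" t d] deriv by simp
  have "d * (u (x + y) + u (x - y) - 2 * u x)
      \<le> \<phi> (u (x + y)) + \<phi> (u (x - y)) - 2 * \<phi> (u x)"
    using tangent[of "u (x + y)"] tangent[of "u (x - y)"] by (simp add: algebra_simps)
  from mult_right_mono[OF this K] show ?thesis
    by (simp add: nonlocal_integrand_def mult.assoc)
qed

theorem mainTheorem5:
  fixes K :: "real ^ 'n \<Rightarrow> real"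
    and u :: "real ^ 'n \<Rightarrow> real"
    and \<phi> :: "real \<Rightarrow> real"
    and x :: "real ^ 'n"
  assumes "K \<in> borel_measurable lebesgue"
    and "\<And>y. 0 \<le> K y"
    and "convex_on UNIV \<phi>"
    and "C2 \<phi>"
    and "nonlocal_converges K u x"
    and "nonlocal_converges K (\<phi> \<circ> u) x"
  shows "nonlocal_operator K (\<phi> \<circ> u) x \<le> deriv \<phi> (u x) * nonlocal_operator K u x"
proof -
  have deriv: "(\<phi> has_real_derivative deriv \<phi> (u x)) (at (u x))"
    using \<open>C2 \<phi>\<close> by (simp add: C2_def DERIV_deriv_iff_real_differentiable)
  \<comment> \<open>Monotonicity needs both sides integrable: these are the two convergence
    assumptions, the first one scaled by a constant.\<close>
  have "(LINT y|lebesgue. deriv \<phi> (u x) * nonlocal_integrand K u x y)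
      \<le> (LINT y|lebesgue. nonlocal_integrand K (\<phi> \<circ> u) x y)"
    using assms(2,5,6) nonlocal_integrand_convex_comp_ge[where u = u and x = x, OF assms(3) deriv]
    by (intro integral_mono) (auto simp: nonlocal_converges_def)
  \<comment> \<open>The constant leaves the integral, and the minus sign in
    \<open>nonlocal_operator\<close> reverses the inequality.\<close>
  then show ?thesis
    by (simp add: nonlocal_operator_def)
qed

end
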